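(* Let $m,n$ be positive integers. For each $k\ge m$, the poset $L^k(m,n)$ is a lattice.
   Context: Fix an integer $k\ge1$. A partition $\lambda=(\lambda_1\ge\dots\ge\lambda_\ell>0)$ is a finite (possibly empty) non-increasing sequence of positive integers, $|\lambda|=\sum_i\lambda_i$, $\ell(\lambda)$ is the number of parts, and $\lambda_i=0$ for $i>\ell(\lambda)$. Its diagram is the set of cells $(i,j)$ with $1\le j\le\lambda_i$ (row $i$, column $j$; row 1 is the lowest row, and "above" means larger row index). $\lambda\subseteq\mu$ means $\lambda_i\le\mu_i$ for all $i$. A partition is $k$-bounded if $\lambda_1\le k$; $\mathcal P^k$ is the set of $k$-bounded partitions. $(m^n)$ is the partition with $n$ parts equal to $m$. For partitions $\rho\subseteq\gamma$, the skew diagram $\gamma/\rho$ is $\{(i,j):\rho_i<j\le\gamma_i\}$; the squares of $\rho$ are said to lie below $\gamma/\rho$. For a square $(i,j)\in\gamma$ (possibly in $\rho$), its hook-length in $\gamma/\rho$ is the number of cells of $\gamma/\rho$ of the form $(i,j')$ with $j'\ge j$ or $(i',j)$ with $i'\ge i$. For $\lambda\in\mathcal P^k$, the $k$-skew diagram $\lambda/^k$ is the unique skew diagram such that (i) row $i$ has $\lambda_i$ cells, (ii) no cell of the diagram has hook-length exceeding $k$, (iii) every square below the diagram has hook-length exceeding $k$. The column lengths of $\lambda/^k$ form a $k$-bounded partition, called the $k$-conjugate $\lambda^{\omega_k}$. For $\lambda,\mu\in\mathcal P^k$ write $\lambda\prec\!\!\cdot\,\mu$ when $\lambda\subseteq\mu$,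 $\lambda^{\omega_k}\subseteq\mu^{\omega_k}$ and $|\mu|-|\lambda|=1$. The partial order $\preceq$ on $\mathcal P^k$ is the reflexive-transitive closure of $\prec\!\!\cdot$; the resulting poset is $Y^k$. For $1\le m\le k$ and $n\ge1$, $L^k(m,n)=\{\mu\in\mathcal P^k:\mu\preceq(m^n)\}$ is the principal order ideal of $Y^k$ generated by $(m^n)$, ordered by $\preceq$. *)

theory Defs
  imports "HOL-Algebra.Lattice"
begin

definition is_partition :: "nat list \<Rightarrow> bool" where
  "is_partition xs \<longleftrightarrow> sorted_wrt (\<ge>) xs \<and> 0 \<notin> set xs"

text \<open>Parts are indexed from 1, with value 0 beyond the length (and at the unused index 0).\<close>

definition part :: "nat list \<Rightarrow> nat \<Rightarrow> nat" where
  "part xs i = (if 1 \<le> i \<and> i \<le> length xs then xs ! (i - 1) else 0)"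

definition partition_le :: "nat list \<Rightarrow> nat list \<Rightarrow> bool" where
  "partition_le xs ys \<longleftrightarrow> (\<forall>i. part xs i \<le> part ys i)"

definition bounded_partitions :: "nat \<Rightarrow> nat list set" where
  "bounded_partitions k = {xs. is_partition xs \<and> part xs 1 \<le> k}"

text \<open>Cells are pairs (row, column); the row with index 1 is the lowest one.\<close>

definition diagram :: "nat list \<Rightarrow> (nat \<times> nat) set" where
  "diagram xs = {(i, j). 1 \<le> i \<and> 1 \<le> j \<and> j \<le> part xs i}"

definition skew :: "nat list \<Rightarrow> nat list \<Rightarrow> (nat \<times> nat) set" where
  "skew \<gamma> \<rho> = {(i, j). 1 \<le> i \<and> part \<rho> i < j \<and> j \<le> part \<gamma> i}"

definition hook_length :: "nat list \<Rightarrow> nat list \<Rightarrow> nat \<times> nat \<Rightarrow> nat" where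
  "hook_length \<gamma> \<rho> c = card {d \<in> skew \<gamma> \<rho>.
     fst d = fst c \<and> snd c \<le> snd d \<or> snd d = snd c \<and> fst c \<le> fst d}"

definition is_k_skew :: "nat \<Rightarrow> nat list \<Rightarrow> nat list \<Rightarrow> nat list \<Rightarrow> bool" where
  "is_k_skew k xs \<gamma> \<rho> \<longleftrightarrow>
     is_partition \<gamma> \<and> is_partition \<rho> \<and> partition_le \<rho> \<gamma> \<and>
     (\<forall>i\<ge>1. card {j. (i, j) \<in> skew \<gamma> \<rho>} = part xs i) \<and>
     (\<forall>c \<in> skew \<gamma> \<rho>. hook_length \<gamma> \<rho> c \<le> k) \<and>
     (\<forall>c \<in> diagram \<rho>. k < hook_length \<gamma> \<rho> c)"

text \<open>
  The \<open>k\<close>-skew diagram of a \<open>k\<close>-bounded partition, as the pair (outer shape, inner shape).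
  Describing it by the pair rather than by its set of cells makes no difference: in any row
  above the last part of \<open>xs\<close> the last condition forces both shapes to be empty, and the
  cells determine both shapes in the non-empty rows below.
\<close>

definition k_skew :: "nat \<Rightarrow> nat list \<Rightarrow> nat list \<times> nat list" where
  "k_skew k xs = (THE p. is_k_skew k xs (fst p) (snd p))"

text \<open>
  Column lengths, from left to right. No column up to the width of the outer shape is empty:
  the topmost square of an empty column would lie below the diagram, with hook-length equal
  to the length of its row, which is at most \<open>k\<close>.
\<close>

definition k_conjugate :: "nat \<Rightarrow> nat list \<Rightarrow> nat list" where
  "k_conjugate k xs = (case k_skew k xs of (\<gamma>, \<rho>) \<Rightarrow>
     map (\<lambda>j. card {i. (i, j) \<in> skew \<gamma> \<rho>}) [1..<Suc (part \<gamma> 1)])"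

definition k_young_cover :: "nat \<Rightarrow> nat list \<Rightarrow> nat list \<Rightarrow> bool" where
  "k_young_cover k xs ys \<longleftrightarrow>
     xs \<in> bounded_partitions k \<and> ys \<in> bounded_partitions k \<and>
     partition_le xs ys \<and> partition_le (k_conjugate k xs) (k_conjugate k ys) \<and>
     sum_list ys = sum_list xs + 1"

definition k_young_le :: "nat \<Rightarrow> nat list \<Rightarrow> nat list \<Rightarrow> bool" where
  "k_young_le k = (k_young_cover k)\<^sup>*\<^sup>*"

definition rect_ideal :: "nat \<Rightarrow> nat \<Rightarrow> nat \<Rightarrow> nat list gorder" where
  "rect_ideal k m n =
     \<lparr> carrier = {xs \<in> bounded_partitions k. k_young_le k xs (replicate n m)},
       eq = (=),
       le = k_young_le k \<rparr>"

end

theory Submission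
  imports Defs
begin

text \<open>
  Put \<open>r = k + 1 - m\<close>. The ideal below the rectangle with \<open>n\<close> parts \<open>m\<close> is a sublattice of
  Young's lattice: it consists of the partitions inside the rectangle that have at most \<open>r\<close>
  nonzero parts smaller than \<open>m\<close>, and on these partitions \<open>k_young_le\<close> is plain containment.
  Written as ``a nonzero part in row \<open>i + r\<close> forces a part of size at least \<open>m\<close> in row \<open>i\<close>''
  (\<open>few_short_parts\<close>), the condition visibly survives part-wise maxima and minima, which are
  therefore joins and meets in the ideal.

  The bound on short parts comes from the shape of the \<open>k\<close>-skew diagram. The hook of a square at
  the left of a row of length \<open>m\<close> exceeds \<open>k\<close> precisely when the column above it has at least
  \<open>r\<close> cells. So if \<open>xs\<close> has few short parts, row \<open>i\<close> starts exactly where row \<open>i + r\<close> ends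
  (\<open>k_skew_stack\<close>): the outer shape is determined by \<open>\<gamma>\<^sub>i = xs\<^sub>i + \<gamma>\<^bsub>i+r\<^esub>\<close>, and a column met by
  \<open>h\<close> rows of \<open>\<gamma>\<close> retains its topmost \<open>min r h\<close> cells. Both \<open>\<gamma>\<close> and these numbers grow with
  \<open>xs\<close>, so among partitions with few short parts containment implies containment of the
  \<open>k\<close>-conjugates (\<open>k_conjugate_mono_few\<close>).

  Conversely, suppose that the parts are at most \<open>m\<close> and that too many of them are short. Then the
  row that lies \<open>r\<close> rows below the top row is short, its first square has a hook of at most \<open>k\<close>,
  and this row and all rows above it start in column 1, which thus has more than \<open>r\<close> cells
  (\<open>few_short_parts_if_k_conjugate_le\<close>). Since \<open>k\<close>-conjugates grow along covers and columns of
  partitions with few short parts have at most \<open>r\<close> cells, no such partition lies below the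
  rectangle.

  It remains to join two comparable partitions with few short parts by a chain of such
  partitions, which is done by adding single cells to the first row in which they differ
  (\<open>few_short_parts_step\<close>).
\<close>

section \<open>Partitions and their parts\<close>

lemma part_0 [simp]: "part xs 0 = 0"
  by (simp add: part_def)

lemma part_Nil [simp]: "part [] i = 0"
  by (simp add: part_def)

lemma part_Cons_1 [simp]: "part (x # xs) (Suc 0) = x"
  by (simp add: part_def)

lemma part_Cons_Suc [simp]: "part (x # xs) (Suc (Suc i)) = part xs (Suc i)"
  by (simp add: part_def)

lemma part_beyond: "length xs < i \<Longrightarrow> part xs i = 0"
  by (simp add: part_def)

lemma part_antimono:
  assumes "is_partition xs" "1 \<le> i" "i \<le> j"
  shows "part xs j \<le> part xs i"
proof (cases "i = j \<or> length xs < j")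
  case False
  then have "i - 1 < j - 1" "j - 1 < length xs" using assms by auto
  then have "xs ! (j - 1) \<le> xs ! (i - 1)"
    using assms(1) by (auto simp: is_partition_def sorted_wrt_iff_nth_less)
  then show ?thesis using assms False by (simp add: part_def)
qed (auto simp: part_beyond)

lemma part_neq_0_iff:
  assumes "is_partition xs"
  shows "part xs i \<noteq> 0 \<longleftrightarrow> 1 \<le> i \<and> i \<le> length xs"
proof -
  have "part xs i \<in> set xs" if "1 \<le> i" "i \<le> length xs"
    using that by (simp add: part_def)
  moreover have "part xs i = 0" if "\<not> (1 \<le> i \<and> i \<le> length xs)"
    using that by (auto simp: part_def)
  ultimately show ?thesis
    using assms unfolding is_partition_def by metis
qed

lemma is_partition_Nil [simp]: "is_partition []"
  by (simp add: is_partition_def)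

lemma is_partition_Cons:
  "is_partition (x # xs) \<longleftrightarrow> is_partition xs \<and> part xs 1 \<le> x \<and> x \<noteq> 0"
proof -
  have "(\<forall>y\<in>set xs. y \<le> x) \<longleftrightarrow> part xs 1 \<le> x" if "sorted_wrt (\<ge>) xs"
    using that by (cases xs) (auto intro: order_trans)
  then show ?thesis
    by (auto simp: is_partition_def)
qed

lemma part_ext:
  assumes "is_partition xs" "is_partition ys" and eq: "\<And>i. 1 \<le> i \<Longrightarrow> part xs i = part ys i"
  shows "xs = ys"
proof (rule nth_equalityI)
  have "\<And>i. 1 \<le> i \<Longrightarrow> i \<le> length xs \<longleftrightarrow> i \<le> length ys"
    using part_neq_0_iff[OF assms(1)] part_neq_0_iff[OF assms(2)] eq by metis
  then show len: "length xs = length ys"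
    by (metis One_nat_def Suc_leI le_antisym nat_le_linear neq0_conv le0)
  show "xs ! i = ys ! i" if "i < length xs" for i
    using eq[of "Suc i"] that len by (simp add: part_def)
qed

text \<open>Used for the set of rows that reach a given column and for the support of a weakly
  decreasing sequence.\<close>

lemma initial_segment:
  fixes A :: "nat set"
  assumes "finite A" "\<And>i. i \<in> A \<Longrightarrow> 1 \<le> i" "\<And>i j. i \<in> A \<Longrightarrow> 1 \<le> j \<Longrightarrow> j \<le> i \<Longrightarrow> j \<in> A"
  shows "A = {1..card A}"
proof (cases "A = {}")
  case False
  then have "Max A \<in> A" using assms(1) by simp
  then have "A = {1..Max A}"
    using assms Max_ge[OF assms(1)] by (metis atLeastAtMost_iff subsetI subset_antisym)
  then have "card A = Max A"
    by (metis card_atLeastAtMost diff_Suc_1)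
  with \<open>A = {1..Max A}\<close> show ?thesis by simp
qed auto

lemma partition_with_parts:
  fixes f :: "nat \<Rightarrow> nat"
  assumes anti: "\<And>i j. 1 \<le> i \<Longrightarrow> i \<le> j \<Longrightarrow> f j \<le> f i" and zero: "\<And>i. N < i \<Longrightarrow> f i = 0"
  obtains xs where "is_partition xs" "\<And>i. 1 \<le> i \<Longrightarrow> part xs i = f i"
proof -
  let ?A = "{i. 1 \<le> i \<and> f i \<noteq> 0}"
  define n where "n = card ?A"
  have "?A \<subseteq> {..N}" using zero by (auto simp: not_less[symmetric])
  then have fin: "finite ?A" by (rule finite_subset) simp
  have A: "?A = {1..n}"
    unfolding n_def using fin by (rule initial_segment) (use anti in \<open>auto, fastforce\<close>)
  define xs where "xs = map f [1..<Suc n]"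
  have nth: "xs ! i = f (Suc i)" "length xs = n" if "i < n" for i
    using that by (simp_all add: xs_def del: upt_Suc)
  have len: "length xs = n" by (simp add: xs_def)
  have "f i \<noteq> 0" if "i \<in> {1..n}" for i using that unfolding A[symmetric] by simp
  then have "0 \<notin> set xs" by (force simp: xs_def)
  moreover have "sorted_wrt (\<ge>) xs"
    unfolding sorted_wrt_iff_nth_less using anti by (auto simp: len nth)
  ultimately have "is_partition xs" by (simp add: is_partition_def)
  moreover have "part xs i = f i" if i: "1 \<le> i" for i
  proof (cases "i \<le> n")
    case True
    with i show ?thesis by (simp add: part_def len nth)
  next
    case False
    then have "i \<notin> ?A" unfolding A by simp
    with i have "f i = 0" by simp
    with False show ?thesis by (simp add: part_def len)
  qed
  ultimately show ?thesis by (rule that)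
qed

lemma sum_list_eq_sum_part:
  "length xs \<le> N \<Longrightarrow> sum_list xs = (\<Sum>i=1..N. part xs i)"
proof (induction xs arbitrary: N)
  case (Cons x xs)
  then obtain M where N: "N = Suc M" by (cases N) auto
  have "(\<Sum>i=1..Suc M. part (x # xs) i) = x + (\<Sum>i=1..M. part (x # xs) (Suc i))"
    using sum.atLeast_Suc_atMost[of 1 "Suc M" "part (x # xs)"]
    by (simp only: sum.shift_bounds_cl_Suc_ivl) simp
  also have "(\<Sum>i=1..M. part (x # xs) (Suc i)) = (\<Sum>i=1..M. part xs i)"
    by (rule sum.cong) (auto simp: part_def nth_Cons')
  finally show ?case using Cons N by simp
qed simp

lemma partition_le_antisym:
  "is_partition xs \<Longrightarrow> is_partition ys \<Longrightarrow> partition_le xs ys \<Longrightarrow> partition_le ys xs \<Longrightarrow> xs = ys"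
  by (rule part_ext) (auto simp: partition_le_def intro: le_antisym)

lemma partition_le_trans:
  "partition_le xs ys \<Longrightarrow> partition_le ys zs \<Longrightarrow> partition_le xs zs"
  unfolding partition_le_def by (blast intro: order_trans)

section \<open>Existence and uniqueness of the \<open>k\<close>-skew diagram\<close>

definition column_length :: "nat list \<Rightarrow> nat list \<Rightarrow> nat \<Rightarrow> nat" where
  "column_length \<gamma> \<rho> j = card {i. (i, j) \<in> skew \<gamma> \<rho>}"

lemma finite_column [simp]: "finite {i. (i, j) \<in> skew \<gamma> \<rho>}"
  by (rule finite_subset[of _ "{..length \<gamma>}"])
    (auto simp: skew_def part_def split: if_splits)

lemma row_eq: "1 \<le> i \<Longrightarrow> {j. (i, j) \<in> skew \<gamma> \<rho>} = {part \<rho> i<..part \<gamma> i}"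
  by (auto simp: skew_def)

lemma hook_length_eq:
  assumes "1 \<le> i"
  shows "hook_length \<gamma> \<rho> (i, j) =
    card ({j..} \<inter> {part \<rho> i<..part \<gamma> i}) + card {i'. i < i' \<and> (i', j) \<in> skew \<gamma> \<rho>}"
proof -
  let ?arm = "{j..} \<inter> {part \<rho> i<..part \<gamma> i}" and ?leg = "{i'. i < i' \<and> (i', j) \<in> skew \<gamma> \<rho>}"
  have "{d \<in> skew \<gamma> \<rho>. fst d = fst (i, j) \<and> snd (i, j) \<le> snd d \<or>
      snd d = snd (i, j) \<and> fst (i, j) \<le> fst d} = {i} \<times> ?arm \<union> ?leg \<times> {j}"
    using assms by (auto simp: skew_def le_less)
  then have "hook_length \<gamma> \<rho> (i, j) = card ({i} \<times> ?arm \<union> ?leg \<times> {j})"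
    by (simp only: hook_length_def)
  also have "\<dots> = card ({i} \<times> ?arm) + card (?leg \<times> {j})"
  proof (rule card_Un_disjoint)
    have "finite ?leg" by (rule finite_subset[OF _ finite_column]) auto
    then show "finite (?leg \<times> {j})" by simp
  qed auto
  finally show ?thesis by (simp add: card_cartesian_product)
qed

lemma skew_row_pos: "(0, j) \<notin> skew \<gamma> \<rho>"
  by (simp add: skew_def)

lemma leg_le_column_length: "card {i'. i < i' \<and> (i', j) \<in> skew \<gamma> \<rho>} \<le> column_length \<gamma> \<rho> j"
  unfolding column_length_def by (rule card_mono) auto

lemma k_skew_row:
  assumes "is_k_skew k xs \<gamma> \<rho>" "1 \<le> i"
  shows "part \<gamma> i = part \<rho> i + part xs i"
proof -
  have "part \<gamma> i - part \<rho> i = part xs i"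
    using assms by (simp add: is_k_skew_def row_eq)
  moreover have "part \<rho> i \<le> part \<gamma> i" using assms by (simp add: is_k_skew_def partition_le_def)
  ultimately show ?thesis by simp
qed

text \<open>If row \<open>i\<close> started further right in the second diagram, then the square in which it starts in
  the first one would have the same arm and the same leg in both, but a hook of at most \<open>k\<close> in
  the first and of more than \<open>k\<close> in the second.\<close>

lemma k_skew_shift_le:
  assumes xs: "is_partition xs" and S: "is_k_skew k xs \<gamma> \<rho>" and T: "is_k_skew k xs \<gamma>' \<rho>'"
    and "1 \<le> i" and above: "\<And>i'. i < i' \<Longrightarrow> part \<rho> i' = part \<rho>' i'"
  shows "part \<rho>' i \<le> part \<rho> i"
proof (rule ccontr)
  assume less: "\<not> part \<rho>' i \<le> part \<rho> i"
  define j where "j = Suc (part \<rho> i)"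
  define leg where "leg = card {i'. i < i' \<and> (i', j) \<in> skew \<gamma> \<rho>}"
  have j: "1 \<le> j" "part \<rho> i < j" "j \<le> part \<rho>' i" using less by (auto simp: j_def)
  have "{i'. i < i' \<and> (i', j) \<in> skew \<gamma> \<rho>} = {i'. i < i' \<and> (i', j) \<in> skew \<gamma>' \<rho>'}"
    using above k_skew_row[OF S] k_skew_row[OF T] by (auto simp: skew_def)
  moreover have "(i, j) \<in> diagram \<rho>'" using j \<open>1 \<le> i\<close> by (simp add: diagram_def)
  then have "k < hook_length \<gamma>' \<rho>' (i, j)" using T by (auto simp: is_k_skew_def)
  moreover have "{j..} \<inter> {part \<rho>' i<..part \<gamma>' i} = {part \<rho>' i<..part \<gamma>' i}"
    using j by auto
  ultimately have k: "k < part xs i + leg"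
    using \<open>1 \<le> i\<close> k_skew_row[OF T] by (simp add: hook_length_eq leg_def)
  show False
  proof (cases "part xs i = 0")
    \<comment> \<open>An empty row has only empty rows above it, so the hook would be empty.\<close>
    case True
    then have "part xs i' = 0" if "i < i'" for i'
      using part_antimono[OF xs \<open>1 \<le> i\<close>, of i'] that by simp
    then have "{i'. i < i' \<and> (i', j) \<in> skew \<gamma> \<rho>} = {}"
      using k_skew_row[OF S] by (auto simp: skew_def)
    then have "leg = 0" by (simp only: leg_def card.empty)
    with k True show False by simp
  next
    case False
    then have "(i, j) \<in> skew \<gamma> \<rho>"
      using \<open>1 \<le> i\<close> k_skew_row[OF S] by (simp add: skew_def j_def)
    then have "hook_length \<gamma> \<rho> (i, j) \<le> k" using S by (auto simp: is_k_skew_def)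
    moreover have "{j..} \<inter> {part \<rho> i<..part \<gamma> i} = {part \<rho> i<..part \<gamma> i}"
      by (auto simp: j_def)
    ultimately have "part xs i + leg \<le> k"
      using \<open>1 \<le> i\<close> k_skew_row[OF S] by (simp add: hook_length_eq leg_def)
    with k show False by simp
  qed
qed

lemma k_skew_unique:
  assumes xs: "is_partition xs" and S: "is_k_skew k xs \<gamma> \<rho>" and T: "is_k_skew k xs \<gamma>' \<rho>'"
  shows "\<gamma> = \<gamma>' \<and> \<rho> = \<rho>'"
proof -
  define N where "N = max (length \<rho>) (length \<rho>')"
  have \<rho>: "1 \<le> i \<longrightarrow> part \<rho> i = part \<rho>' i" for i
  proof (induction "N - i" arbitrary: i rule: less_induct)
    case less
    show ?case
    proof (cases "N < i")
      case True
      then show ?thesis by (simp add: N_def part_beyond)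
    next
      case False
      then have "part \<rho> i' = part \<rho>' i'" if "i < i'" for i'
        using less[of i'] that by (cases "i' \<le> N") (auto simp: N_def part_beyond)
      then show ?thesis
        using k_skew_shift_le[OF xs S T] k_skew_shift_le[OF xs T S] by (metis le_antisym)
    qed
  qed
  moreover have "part \<gamma> i = part \<gamma>' i" if "1 \<le> i" for i
    using \<rho> that k_skew_row[OF S] k_skew_row[OF T] by simp
  ultimately show ?thesis
    using S T part_ext[of \<gamma> \<gamma>'] part_ext[of \<rho> \<rho>'] by (simp add: is_k_skew_def)
qed

lemma k_skew_eq:
  assumes "is_partition xs" "is_k_skew k xs \<gamma> \<rho>"
  shows "k_skew k xs = (\<gamma>, \<rho>)"
  unfolding k_skew_def
proof (rule the_equality)
  show "p = (\<gamma>, \<rho>)" if "is_k_skew k xs (fst p) (snd p)" for p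
    using k_skew_unique[OF assms(1) that assms(2)] by (simp add: prod_eq_iff)
qed (simp add: assms(2))

text \<open>Putting a row that starts in column \<open>s + 1\<close> under a diagram prepends \<open>s\<close> to its inner shape. If
  \<open>s = 0\<close> the inner shape must have been empty already, and prepending would create a zero part.\<close>

definition add_row :: "nat \<Rightarrow> nat list \<Rightarrow> nat list" where
  "add_row s \<rho> = (if s = 0 then [] else s # \<rho>)"

lemma part_add_row [simp]:
  "part (add_row s \<rho>) (Suc 0) = s"
  "is_partition \<rho> \<Longrightarrow> part \<rho> (Suc 0) \<le> s \<Longrightarrow>
    part (add_row s \<rho>) (Suc (Suc i)) = part \<rho> (Suc i)"
  using part_antimono[of \<rho> "Suc 0" "Suc i"] by (auto simp: add_row_def)

lemma skew_add_row:
  assumes "is_partition \<rho>" "part \<rho> 1 \<le> s"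
  shows "(Suc 0, j) \<in> skew (y # \<gamma>) (add_row s \<rho>) \<longleftrightarrow> s < j \<and> j \<le> y"
    and "(Suc (Suc i), j) \<in> skew (y # \<gamma>) (add_row s \<rho>) \<longleftrightarrow> (Suc i, j) \<in> skew \<gamma> \<rho>"
  using assms by (auto simp: skew_def)

lemma leg_add_row:
  assumes "is_partition \<rho>" "part \<rho> 1 \<le> s"
  shows "{i'. Suc i < i' \<and> (i', j) \<in> skew (y # \<gamma>) (add_row s \<rho>)} =
    Suc ` {i'. i < i' \<and> (i', j) \<in> skew \<gamma> \<rho>}" (is "?L = Suc ` ?R")
proof -
  have "i' \<in> ?L \<longleftrightarrow> i' \<in> Suc ` ?R" for i'
  proof (cases i')
    case (Suc l)
    then show ?thesis using skew_add_row(2)[OF assms] by (cases l) (auto simp: skew_def)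
  qed auto
  then show ?thesis by blast
qed

lemma column_length_add_row:
  assumes "is_partition \<rho>" "part \<rho> 1 \<le> s"
  shows "column_length (y # \<gamma>) (add_row s \<rho>) j =
    column_length \<gamma> \<rho> j + (if s < j \<and> j \<le> y then 1 else 0)"
proof -
  let ?C = "{i. (i, j) \<in> skew \<gamma> \<rho>}"
  note 0 = skew_row_pos
  have "{i. (i, j) \<in> skew (y # \<gamma>) (add_row s \<rho>)} =
      (if s < j \<and> j \<le> y then {Suc 0} else {}) \<union> Suc ` ?C" (is "?L = ?R")
  proof -
    have "i \<in> ?L \<longleftrightarrow> i \<in> ?R" for i
    proof (cases i)
      case (Suc l)
      then show ?thesis using skew_add_row[OF assms] 0 by (cases l) (auto simp: image_iff)
    qed (use 0 in auto)
    then show ?thesis by blast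
  qed
  moreover have "card (Suc ` ?C) = column_length \<gamma> \<rho> j"
    by (simp add: column_length_def card_image)
  moreover have "Suc 0 \<notin> Suc ` ?C" using 0 by auto
  ultimately show ?thesis
    by (simp add: column_length_def)
qed

lemma hook_length_add_row:
  assumes "is_partition \<rho>" "part \<rho> 1 \<le> s"
  shows "hook_length (y # \<gamma>) (add_row s \<rho>) (Suc 0, j) =
      card ({j..} \<inter> {s<..y}) + column_length \<gamma> \<rho> j"
    and "hook_length (y # \<gamma>) (add_row s \<rho>) (Suc (Suc i), j) = hook_length \<gamma> \<rho> (Suc i, j)"
proof -
  have "{i'. 0 < i' \<and> (i', j) \<in> skew \<gamma> \<rho>} = {i'. (i', j) \<in> skew \<gamma> \<rho>}"
    by (auto simp: skew_def)
  then show "hook_length (y # \<gamma>) (add_row s \<rho>) (Suc 0, j) =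
      card ({j..} \<inter> {s<..y}) + column_length \<gamma> \<rho> j"
    using leg_add_row[OF assms, of 0]
    by (simp add: hook_length_eq card_image column_length_def)
  show "hook_length (y # \<gamma>) (add_row s \<rho>) (Suc (Suc i), j) = hook_length \<gamma> \<rho> (Suc i, j)"
    using assms by (simp add: hook_length_eq leg_add_row card_image)
qed

text \<open>The squares to the left of row 1 have hooks exceeding \<open>k\<close>. A new row under it that is at
  least as long has even longer hooks in these columns, so it must skip them too.\<close>

lemma k_skew_first_shift_le:
  assumes S: "is_k_skew k xs \<gamma> \<rho>" and x: "part xs 1 \<le> x"
    and right: "x + column_length \<gamma> \<rho> (Suc s) \<le> k"
  shows "part \<rho> 1 \<le> s"
proof (rule ccontr)
  assume "\<not> part \<rho> 1 \<le> s"
  then have j: "Suc s \<le> part \<rho> 1" by simp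
  then have "(1, Suc s) \<in> diagram \<rho>" by (simp add: diagram_def)
  then have "k < hook_length \<gamma> \<rho> (1, Suc s)" using S by (auto simp: is_k_skew_def)
  also have "\<dots> \<le> part xs 1 + column_length \<gamma> \<rho> (Suc s)"
  proof -
    have "card ({Suc s..} \<inter> {part \<rho> 1<..part \<gamma> 1}) \<le> card {part \<rho> 1<..part \<gamma> 1}"
      by (rule card_mono) auto
    then show ?thesis
      using k_skew_row[OF S, of 1] leg_le_column_length[of 1 "Suc s" \<gamma> \<rho>]
      by (simp add: hook_length_eq)
  qed
  finally show False using x right by simp
qed

text \<open>Only the new row creates new hooks. The columns get shorter from left to right, so its hooks
  do as well, and \<open>s\<close> is the place where they pass the bound \<open>k\<close>.\<close>

lemma k_skew_add_row:
  assumes S: "is_k_skew k xs \<gamma> \<rho>" and x: "is_partition (x # xs)"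
    and anti: "\<And>i j. 1 \<le> i \<Longrightarrow> i \<le> j \<Longrightarrow> column_length \<gamma> \<rho> j \<le> column_length \<gamma> \<rho> i"
    and left: "\<And>j. 1 \<le> j \<Longrightarrow> j \<le> s \<Longrightarrow> k < x + column_length \<gamma> \<rho> j"
    and right: "x + column_length \<gamma> \<rho> (Suc s) \<le> k"
  shows "is_k_skew k (x # xs) ((s + x) # \<gamma>) (add_row s \<rho>)"
proof -
  have \<gamma>: "is_partition \<gamma>" and \<rho>: "is_partition \<rho>" and le: "partition_le \<rho> \<gamma>"
    using S by (auto simp: is_k_skew_def)
  have x0: "x \<noteq> 0" "part xs 1 \<le> x" using x by (auto simp: is_partition_Cons)
  have s: "part \<rho> 1 \<le> s" by (rule k_skew_first_shift_le[OF S x0(2) right])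
  have top: "part \<gamma> 1 \<le> s + x" using k_skew_row[OF S, of 1] s x0 by simp
  have rows: "card {j. (i, j) \<in> skew ((s + x) # \<gamma>) (add_row s \<rho>)} = part (x # xs) i"
    if "1 \<le> i" for i
  proof (cases "i = 1")
    case True
    have "{j. s < j \<and> j \<le> s + x} = {s<..s + x}" by auto
    then show ?thesis using True skew_add_row(1)[OF \<rho> s] by simp
  next
    case False
    with that obtain l where "i = Suc (Suc l)"
      by (cases i; cases "i - 1") auto
    then show ?thesis
      using skew_add_row(2)[OF \<rho> s] S by (simp add: is_k_skew_def)
  qed
  have hooks: "hook_length ((s + x) # \<gamma>) (add_row s \<rho>) c \<le> k"
    if "c \<in> skew ((s + x) # \<gamma>) (add_row s \<rho>)" for c
  proof -
    obtain i' j where c': "c = (i', j)" by (cases c)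
    with that obtain i where "i' = Suc i" by (cases i') (auto simp: skew_def)
    with c' have c: "c = (Suc i, j)" by simp
    show ?thesis
    proof (cases i)
      case 0
      then have j: "s < j" "j \<le> s + x" using that c skew_add_row(1)[OF \<rho> s] by auto
      have "card ({j..} \<inter> {s<..s + x}) \<le> card {s<..s + x}" by (rule card_mono) auto
      moreover have "column_length \<gamma> \<rho> j \<le> column_length \<gamma> \<rho> (Suc s)" using anti j by simp
      ultimately show ?thesis
        using c 0 right hook_length_add_row(1)[OF \<rho> s] by simp
    next
      case (Suc l)
      then show ?thesis
        using that c S hook_length_add_row(2)[OF \<rho> s] skew_add_row(2)[OF \<rho> s]
        by (auto simp: is_k_skew_def)
    qed
  qed
  have below: "k < hook_length ((s + x) # \<gamma>) (add_row s \<rho>) c" if "c \<in> diagram (add_row s \<rho>)" for c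
  proof -
    obtain i' j where c': "c = (i', j)" by (cases c)
    with that obtain i where "i' = Suc i" by (cases i') (auto simp: diagram_def)
    with c' have c: "c = (Suc i, j)" by simp
    show ?thesis
    proof (cases i)
      case 0
      then have j: "1 \<le> j" "j \<le> s" using that c by (auto simp: diagram_def)
      then have "{j..} \<inter> {s<..s + x} = {s<..s + x}" by auto
      then show ?thesis using c 0 left[OF j] hook_length_add_row(1)[OF \<rho> s] by simp
    next
      case (Suc l)
      then have "(Suc l, j) \<in> diagram \<rho>" using that c \<rho> s by (auto simp: diagram_def)
      then show ?thesis
        using c Suc S hook_length_add_row(2)[OF \<rho> s] by (auto simp: is_k_skew_def)
    qed
  qed
  have "is_partition ((s + x) # \<gamma>)" using \<gamma> top x0 by (simp add: is_partition_Cons)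
  moreover have "is_partition (add_row s \<rho>)"
    using \<rho> s by (simp add: add_row_def is_partition_Cons)
  moreover have "partition_le (add_row s \<rho>) ((s + x) # \<gamma>)"
    unfolding partition_le_def
  proof
    fix i
    show "part (add_row s \<rho>) i \<le> part ((s + x) # \<gamma>) i"
    proof (cases i)
      case (Suc l)
      then show ?thesis using \<rho> s le by (cases l) (auto simp: partition_le_def)
    qed simp
  qed
  ultimately show ?thesis
    using rows hooks below by (auto simp: is_k_skew_def)
qed

lemma k_skew_Nil: "is_k_skew k [] [] []"
  by (auto simp: is_k_skew_def partition_le_def skew_def diagram_def)

text \<open>The diagram is built from the top row downwards. The induction carries along that the columns
  get shorter from left to right: without it, the squares with hooks exceeding \<open>k\<close> need not be the
  leftmost ones of a new row.\<close>

lemma k_skew_exists: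
  assumes "xs \<in> bounded_partitions k"
  shows "\<exists>\<gamma> \<rho>. is_k_skew k xs \<gamma> \<rho>"
proof -
  have "\<exists>\<gamma> \<rho>. is_k_skew k xs \<gamma> \<rho> \<and>
      (\<forall>i j. 1 \<le> i \<longrightarrow> i \<le> j \<longrightarrow> column_length \<gamma> \<rho> j \<le> column_length \<gamma> \<rho> i)"
    if "is_partition xs" "part xs 1 \<le> k"
    using that
  proof (induction xs)
    case Nil
    show ?case
      by (intro exI[of _ "[]"] conjI k_skew_Nil) (simp add: column_length_def skew_def)
  next
    case (Cons x xs)
    then have "is_partition xs" "part xs 1 \<le> k" "x \<le> k" by (auto simp: is_partition_Cons)
    with Cons.IH obtain \<gamma> \<rho> where S: "is_k_skew k xs \<gamma> \<rho>"
      and anti: "\<And>i j. 1 \<le> i \<Longrightarrow> i \<le> j \<Longrightarrow> column_length \<gamma> \<rho> j \<le> column_length \<gamma> \<rho> i"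
      by blast
    have \<gamma>: "is_partition \<gamma>" and \<rho>: "is_partition \<rho>"
      using S by (auto simp: is_k_skew_def)
    \<comment> \<open>The shift is the least one that brings all hooks of the new row down to \<open>k\<close>.\<close>
    define P where "P s \<longleftrightarrow> x + column_length \<gamma> \<rho> (Suc s) \<le> k" for s
    define s where "s = (LEAST s. P s)"
    have "part \<gamma> i \<le> part \<gamma> 1" if "1 \<le> i" for i using part_antimono[OF \<gamma>, of 1 i] that by simp
    then have "{i. (i, Suc (part \<gamma> 1)) \<in> skew \<gamma> \<rho>} = {}"
      by (auto simp: skew_def not_less_eq_eq[symmetric])
    then have "P (part \<gamma> 1)" using \<open>x \<le> k\<close> by (simp add: P_def column_length_def)
    then have "P s" unfolding s_def by (rule LeastI)
    then have right: "x + column_length \<gamma> \<rho> (Suc s) \<le> k" by (simp add: P_def)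
    have left: "k < x + column_length \<gamma> \<rho> j" if "1 \<le> j" "j \<le> s" for j
    proof -
      have "\<not> P (j - 1)" using that by (intro not_less_Least) (simp add: s_def)
      then show ?thesis using that by (simp add: P_def)
    qed
    have S': "is_k_skew k (x # xs) ((s + x) # \<gamma>) (add_row s \<rho>)"
      by (rule k_skew_add_row) (use S Cons.prems anti left right in auto)
    have "part \<rho> 1 \<le> s"
      using Cons.prems by (intro k_skew_first_shift_le[OF S _ right]) (simp add: is_partition_Cons)
    \<comment> \<open>The new row lengthens columns to the right of \<open>s\<close>. Column \<open>s\<close> was strictly longer than
      column \<open>s + 1\<close>, so adding one cell cannot break the monotonicity.\<close>
    have "column_length ((s + x) # \<gamma>) (add_row s \<rho>) j
        \<le> column_length ((s + x) # \<gamma>) (add_row s \<rho>) i" if "1 \<le> i" "i \<le> j" for i j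
    proof (cases "i \<le> s \<and> s < j")
      case True
      then have "k < x + column_length \<gamma> \<rho> i" using left \<open>1 \<le> i\<close> by simp
      moreover have "column_length \<gamma> \<rho> j \<le> column_length \<gamma> \<rho> (Suc s)" using anti True by simp
      ultimately show ?thesis
        using right by (simp add: column_length_add_row[OF \<rho> \<open>part \<rho> 1 \<le> s\<close>])
    next
      case False
      then show ?thesis
        using anti[OF that] that by (auto simp: column_length_add_row[OF \<rho> \<open>part \<rho> 1 \<le> s\<close>])
    qed
    with S' show ?case by blast
  qed
  then show ?thesis using assms by (auto simp: bounded_partitions_def)
qed

lemma part_k_conjugate:
  assumes "is_partition xs" "is_k_skew k xs \<gamma> \<rho>" "1 \<le> j"
  shows "part (k_conjugate k xs) j = column_length \<gamma> \<rho> j"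
proof (cases "j \<le> part \<gamma> 1")
  case True
  define c where "c = k_conjugate k xs"
  have c: "c = map (column_length \<gamma> \<rho>) [1..<Suc (part \<gamma> 1)]"
    using assms by (simp add: c_def k_conjugate_def k_skew_eq column_length_def del: upt_Suc)
  have "j - 1 < part \<gamma> 1" using True assms(3) by simp
  then have "c ! (j - 1) = column_length \<gamma> \<rho> j" and "length c = part \<gamma> 1"
    using assms(3) by (simp_all add: c del: upt_Suc)
  then show ?thesis using True assms(3) unfolding c_def[symmetric] by (simp add: part_def[of c])
next
  case False
  have "is_partition \<gamma>" using assms by (simp add: is_k_skew_def)
  then have "part \<gamma> i < j" if "1 \<le> i" for i
    using part_antimono[of \<gamma> 1 i] that False by simp
  then have "{i. (i, j) \<in> skew \<gamma> \<rho>} = {}" by (force simp: skew_def)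
  then have "column_length \<gamma> \<rho> j = 0" by (simp only: column_length_def card.empty)
  moreover have "length (k_conjugate k xs) = part \<gamma> 1"
    using assms by (simp add: k_conjugate_def k_skew_eq)
  ultimately show ?thesis using False by (simp add: part_beyond)
qed

section \<open>Partitions with few short parts\<close>

text \<open>For parts bounded by \<open>m\<close> this says that at most \<open>r\<close> nonzero parts are smaller than \<open>m\<close>. The
  formulation by single rows makes it stable under part-wise maxima and minima.\<close>

definition few_short_parts :: "nat \<Rightarrow> nat \<Rightarrow> nat list \<Rightarrow> bool" where
  "few_short_parts r m xs \<longleftrightarrow> (\<forall>i\<ge>1. part xs (i + r) \<noteq> 0 \<longrightarrow> m \<le> part xs i)"

text \<open>The outer shape of a diagram in which every row starts where the row \<open>r\<close> places above it ends.
  In the second equation that row has index \<open>r\<close> in the shape built so far.\<close>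

fun stack :: "nat \<Rightarrow> nat list \<Rightarrow> nat list" where
  "stack r [] = []"
| "stack r (x # xs) = (part (stack r xs) r + x) # stack r xs"

lemma length_stack [simp]: "length (stack r xs) = length xs"
  by (induction xs) auto

lemma part_stack:
  assumes "1 \<le> r" "1 \<le> i"
  shows "part (stack r xs) i = part (stack r xs) (i + r) + part xs i"
  using assms(2)
proof (induction xs arbitrary: i)
  case (Cons x xs)
  obtain r' where r: "r = Suc r'" using assms(1) by (cases r) auto
  show ?case
  proof (cases "i = 1")
    case False
    then obtain l where "i = Suc (Suc l)"
      using Cons.prems by (cases i; cases "i - 1") auto
    then show ?thesis using Cons.IH[of "Suc l"] by (simp add: r)
  qed (simp add: r)
qed simp

lemma is_partition_stack:
  assumes "1 \<le> r" "is_partition xs"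
  shows "is_partition (stack r xs)"
  using assms(2)
proof (induction xs)
  case (Cons x xs)
  then have g: "is_partition (stack r xs)" and "part xs 1 \<le> x" "x \<noteq> 0"
    by (auto simp: is_partition_Cons)
  moreover have "part (stack r xs) (1 + r) \<le> part (stack r xs) r"
    using part_antimono[OF g] assms(1) by simp
  ultimately show ?case
    using part_stack[OF assms(1), of 1 xs] by (simp add: is_partition_Cons)
qed simp

lemma part_drop: "1 \<le> i \<Longrightarrow> part (drop r xs) i = part xs (i + r)"
  by (auto simp: part_def add.commute)

text \<open>The part in row \<open>i\<close> of the stack is the sum of the parts of \<open>xs\<close> in rows
  \<open>i, i + r, i + 2 r, \<dots>\<close>.\<close>

lemma stack_mono:
  assumes "1 \<le> r" "partition_le xs ys" "1 \<le> i"
  shows "part (stack r xs) i \<le> part (stack r ys) i"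
  using assms(3)
proof (induction "length xs - i" arbitrary: i rule: less_induct)
  case less
  show ?case
  proof (cases "length xs < i")
    case False
    then have "part (stack r xs) (i + r) \<le> part (stack r ys) (i + r)"
      using less assms(1) by (cases "i + r \<le> length xs") (auto simp: part_beyond)
    moreover have "part xs i \<le> part ys i" using assms(2) by (simp add: partition_le_def)
    ultimately show ?thesis
      using part_stack[OF assms(1) less.prems] by (simp add: add_mono)
  qed (simp add: part_beyond)
qed

definition rows_reaching :: "nat list \<Rightarrow> nat \<Rightarrow> nat set" where
  "rows_reaching \<gamma> j = {i. 1 \<le> i \<and> j \<le> part \<gamma> i}"

lemma finite_rows_reaching:
  assumes "1 \<le> j"
  shows "finite (rows_reaching \<gamma> j)"
  by (rule finite_subset[of _ "{..length \<gamma>}"])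
    (use assms in \<open>auto simp: rows_reaching_def part_def split: if_splits\<close>)

lemma mem_rows_reaching_iff:
  assumes "is_partition \<gamma>" "1 \<le> j"
  shows "i \<in> rows_reaching \<gamma> j \<longleftrightarrow> 1 \<le> i \<and> i \<le> card (rows_reaching \<gamma> j)"
proof -
  have "rows_reaching \<gamma> j = {1..card (rows_reaching \<gamma> j)}"
  proof (rule initial_segment[OF finite_rows_reaching[OF assms(2)]])
    fix a b assume "a \<in> rows_reaching \<gamma> j" "1 \<le> b" "b \<le> a"
    then show "b \<in> rows_reaching \<gamma> j"
      using part_antimono[OF assms(1), of b a] by (simp add: rows_reaching_def)
  qed (simp add: rows_reaching_def)
  then show ?thesis by (metis atLeastAtMost_iff)
qed

text \<open>The rows of \<open>\<gamma>\<close> that reach column \<open>j\<close> are \<open>1, \<dots>, h\<close>. The inner shape removes those for which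
  the row \<open>r\<close> places above reaches column \<open>j\<close> as well, which leaves the topmost \<open>min r h\<close>.\<close>

lemma column_length_drop:
  assumes "is_partition \<gamma>" "1 \<le> j"
  shows "column_length \<gamma> (drop r \<gamma>) j = min r (card (rows_reaching \<gamma> j))"
proof -
  define h where "h = card (rows_reaching \<gamma> j)"
  have h: "1 \<le> i \<and> j \<le> part \<gamma> i \<longleftrightarrow> 1 \<le> i \<and> i \<le> h" for i
    using mem_rows_reaching_iff[OF assms, of i] by (simp add: rows_reaching_def h_def)
  have "(i, j) \<in> skew \<gamma> (drop r \<gamma>) \<longleftrightarrow> i \<in> {Suc (h - r)..h}" for i
    using h[of i] h[of "i + r"] by (auto simp: skew_def part_drop)
  then have "{i. (i, j) \<in> skew \<gamma> (drop r \<gamma>)} = {Suc (h - r)..h}" by blast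
  then show ?thesis by (simp add: column_length_def h_def)
qed

text \<open>A square to the left of a row \<open>i\<close> lies under a column with \<open>r\<close> cells, and since row \<open>i + r\<close> is
  then not empty, row \<open>i\<close> has length \<open>m\<close>: the hook is \<open>m + r = k + 1\<close>. The first cell of the row
  lies under a column with fewer than \<open>r\<close> cells, so its hook is at most \<open>m + r - 1 = k\<close>.\<close>

lemma k_skew_stack:
  assumes r: "1 \<le> r" "m + r = Suc k"
    and "is_partition xs" "part xs 1 \<le> m" "few_short_parts r m xs"
  shows "is_k_skew k xs (stack r xs) (drop r (stack r xs))"
  using assms(3-)
proof (induction xs)
  case Nil
  show ?case using k_skew_Nil by simp
next
  case (Cons x xs)
  define g where "g = stack r xs"
  define s where "s = part g r"
  have x: "x \<le> m" "part xs 1 \<le> x" "is_partition xs"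
    using Cons.prems by (auto simp: is_partition_Cons)
  have g: "is_partition g" unfolding g_def by (rule is_partition_stack[OF r(1) x(3)])
  have "few_short_parts r m xs"
    unfolding few_short_parts_def
  proof (intro allI impI)
    fix i assume "1 \<le> i" "part xs (i + r) \<noteq> 0"
    then show "m \<le> part xs i"
      using Cons.prems(3)[unfolded few_short_parts_def, rule_format, of "Suc i"]
      by (cases i) auto
  qed
  then have S: "is_k_skew k xs g (drop r g)" using Cons.IH x by (simp add: g_def)
  have anti: "column_length g (drop r g) j \<le> column_length g (drop r g) i"
    if "1 \<le> i" "i \<le> j" for i j
  proof -
    have "card (rows_reaching g j) \<le> card (rows_reaching g i)"
      by (rule card_mono) (use that in \<open>auto simp: finite_rows_reaching, auto simp: rows_reaching_def\<close>)
    then show ?thesis using that by (auto simp: column_length_drop[OF g])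
  qed
  have left: "k < x + column_length g (drop r g) j" if j: "1 \<le> j" "j \<le> s" for j
  proof -
    have "r \<in> rows_reaching g j" using r(1) j by (simp add: rows_reaching_def s_def)
    then have "r \<le> card (rows_reaching g j)" using mem_rows_reaching_iff[OF g j(1)] by simp
    moreover have "part g r \<noteq> 0" using j by (simp add: s_def)
    then have "part xs r \<noteq> 0"
      using part_neq_0_iff[OF g, of r] part_neq_0_iff[OF x(3), of r] by (simp add: g_def)
    then have "m \<le> x"
      using r(1) Cons.prems(3)[unfolded few_short_parts_def, rule_format, of 1] by (cases r) auto
    ultimately show ?thesis using r j by (simp add: column_length_drop[OF g])
  qed
  have "r \<notin> rows_reaching g (Suc s)" by (simp add: rows_reaching_def s_def)
  then have "card (rows_reaching g (Suc s)) < r"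
    using mem_rows_reaching_iff[OF g, of "Suc s" r] r(1) by simp
  then have right: "x + column_length g (drop r g) (Suc s) \<le> k"
    using r x by (simp add: column_length_drop[OF g])
  have "drop r (stack r (x # xs)) = add_row s (drop r g)"
  proof -
    obtain r' where r': "r = Suc r'" using r(1) by (cases r) auto
    show ?thesis
    proof (cases "s = 0")
      case True
      then have "length g \<le> r'"
        using part_neq_0_iff[OF g, of r] r' by (auto simp: s_def)
      then show ?thesis using True by (simp add: add_row_def r' g_def)
    next
      case False
      then have "r' < length g" and "s = g ! r'"
        using part_neq_0_iff[OF g, of r] r' by (auto simp: s_def part_def)
      then show ?thesis
        using False Cons_nth_drop_Suc[of r' g] by (simp add: add_row_def r' flip: g_def[unfolded r'])
    qed
  qed
  then show ?case
    using k_skew_add_row[OF S Cons.prems(1) anti left right] by (simp add: g_def s_def)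
qed

lemma part_k_conjugate_few:
  assumes "1 \<le> r" "m + r = Suc k" "is_partition xs" "part xs 1 \<le> m" "few_short_parts r m xs" "1 \<le> j"
  shows "part (k_conjugate k xs) j = min r (card (rows_reaching (stack r xs) j))"
  using part_k_conjugate[OF assms(3) k_skew_stack[OF assms(1-5)] assms(6)]
    column_length_drop[OF is_partition_stack[OF assms(1,3)] assms(6)] by simp

lemma k_conjugate_mono_few:
  assumes r: "1 \<le> r" "m + r = Suc k"
    and xs: "is_partition xs" "few_short_parts r m xs"
    and ys: "is_partition ys" "part ys 1 \<le> m" "few_short_parts r m ys"
    and le: "partition_le xs ys"
  shows "partition_le (k_conjugate k xs) (k_conjugate k ys)"
  unfolding partition_le_def
proof
  fix j
  have xs1: "part xs 1 \<le> m" using le ys(2) by (meson order_trans partition_le_def)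
  show "part (k_conjugate k xs) j \<le> part (k_conjugate k ys) j"
  proof (cases "j = 0")
    case False
    then have j: "1 \<le> j" by simp
    have "rows_reaching (stack r xs) j \<subseteq> rows_reaching (stack r ys) j"
      using stack_mono[OF r(1) le] by (force simp: rows_reaching_def)
    then have "card (rows_reaching (stack r xs) j) \<le> card (rows_reaching (stack r ys) j)"
      by (rule card_mono[OF finite_rows_reaching[OF j]])
    then show ?thesis
      using part_k_conjugate_few[OF r xs(1) xs1 xs(2) j] part_k_conjugate_few[OF r ys j] by auto
  qed simp
qed

text \<open>If the condition fails at some row, then it fails at row \<open>p = length xs - r\<close> too, because parts
  decrease. The first square of row \<open>p\<close> has an arm of fewer than \<open>m\<close> cells and at most \<open>r\<close> cells
  above it, so its hook is at most \<open>k\<close> and row \<open>p\<close> starts in column 1. Hence so do the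
  \<open>r\<close> rows above it, and the first column has at least \<open>r + 1\<close> cells.\<close>

lemma few_short_parts_if_k_conjugate_le:
  assumes r: "1 \<le> r" "m + r = Suc k"
    and xs: "is_partition xs" "part xs 1 \<le> m" and conj: "part (k_conjugate k xs) 1 \<le> r"
  shows "few_short_parts r m xs"
proof (rule ccontr)
  assume "\<not> few_short_parts r m xs"
  then obtain i where i: "1 \<le> i" "part xs (i + r) \<noteq> 0" "part xs i < m"
    by (auto simp: few_short_parts_def not_le)
  define p where "p = length xs - r"
  have len: "i + r \<le> length xs" using part_neq_0_iff[OF xs(1)] i(2) by simp
  then have p: "i \<le> p" "length xs = p + r" by (auto simp: p_def)
  have "xs \<in> bounded_partitions k" using xs r by (simp add: bounded_partitions_def)
  then obtain \<gamma> \<rho> where S: "is_k_skew k xs \<gamma> \<rho>" using k_skew_exists by blast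
  have \<rho>: "is_partition \<rho>" using S by (simp add: is_k_skew_def)
  have "part \<rho> p = 0"
  proof (rule ccontr)
    assume "part \<rho> p \<noteq> 0"
    then have "(p, 1) \<in> diagram \<rho>" using i p by (simp add: diagram_def)
    then have "k < hook_length \<gamma> \<rho> (p, 1)" using S by (auto simp: is_k_skew_def)
    moreover have "card ({1..} \<inter> {part \<rho> p<..part \<gamma> p}) \<le> card {part \<rho> p<..part \<gamma> p}"
      by (rule card_mono) auto
    moreover have "card {part \<rho> p<..part \<gamma> p} < m"
      using k_skew_row[OF S, of p] part_antimono[OF xs(1) i(1) p(1)] i p by simp
    moreover have "card {i'. p < i' \<and> (i', 1) \<in> skew \<gamma> \<rho>} \<le> card {p<..length xs}"
    proof (rule card_mono)
      show "{i'. p < i' \<and> (i', 1) \<in> skew \<gamma> \<rho>} \<subseteq> {p<..length xs}"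
      proof
        fix i' assume "i' \<in> {i'. p < i' \<and> (i', 1) \<in> skew \<gamma> \<rho>}"
        then have i': "p < i'" "part \<rho> i' < part \<gamma> i'" by (auto simp: skew_def)
        then have "part xs i' \<noteq> 0" using k_skew_row[OF S, of i'] by simp
        then show "i' \<in> {p<..length xs}" using part_neq_0_iff[OF xs(1)] i' by simp
      qed
    qed simp
    ultimately show False using i p r by (simp add: hook_length_eq)
  qed
  have "{p..length xs} \<subseteq> {i'. (i', 1) \<in> skew \<gamma> \<rho>}"
  proof
    fix i' assume i': "i' \<in> {p..length xs}"
    then have "part \<rho> i' = 0"
      using part_antimono[OF \<rho>, of p i'] \<open>part \<rho> p = 0\<close> i p by simp
    moreover have "part xs i' \<noteq> 0" using part_neq_0_iff[OF xs(1)] i' i p by simp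
    ultimately show "i' \<in> {i'. (i', 1) \<in> skew \<gamma> \<rho>}"
      using k_skew_row[OF S, of i'] i' i p by (simp add: skew_def)
  qed
  then have "card {p..length xs} \<le> column_length \<gamma> \<rho> 1"
    unfolding column_length_def by (rule card_mono[OF finite_column])
  then show False using conj part_k_conjugate[OF xs(1) S, of 1] p by simp
qed

section \<open>The order ideal of a rectangle\<close>

lemma sum_list_mono_partition:
  assumes "partition_le xs ys"
  shows "sum_list xs \<le> sum_list ys"
  using assms sum_list_eq_sum_part[of xs "length xs + length ys"]
    sum_list_eq_sum_part[of ys "length xs + length ys"]
  by (simp add: partition_le_def sum_mono)

text \<open>The cell is added to the first row \<open>i\<close> in which the two partitions differ. Before row \<open>i\<close> they
  agree, so both the monotonicity of the parts and the condition that row \<open>i\<close> imposes on row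
  \<open>i - r\<close> are inherited from \<open>ys\<close>; all other conditions are inherited from \<open>xs\<close>.\<close>

lemma few_short_parts_step:
  assumes r: "1 \<le> r"
    and xs: "is_partition xs" "few_short_parts r m xs"
    and ys: "is_partition ys" "few_short_parts r m ys"
    and le: "partition_le xs ys" and "xs \<noteq> ys"
  obtains zs where "is_partition zs" "few_short_parts r m zs" "partition_le xs zs"
    "partition_le zs ys" "sum_list zs = sum_list xs + 1"
proof -
  have "\<exists>i. part xs i < part ys i"
  proof (rule ccontr)
    assume "\<nexists>i. part xs i < part ys i"
    then have "partition_le ys xs" by (simp add: partition_le_def not_less)
    then show False using partition_le_antisym[OF xs(1) ys(1) le] \<open>xs \<noteq> ys\<close> by simp
  qed
  then obtain i where i: "part xs i < part ys i" and min: "\<forall>j<i. \<not> part xs j < part ys j"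
    unfolding exists_least_iff[of "\<lambda>i. part xs i < part ys i"] by blast
  have eq: "part xs j = part ys j" if "j < i" for j
    using min[rule_format, OF that] le[unfolded partition_le_def, rule_format, of j] by simp
  have i1: "1 \<le> i" "i \<le> length ys" using i by (auto simp: part_def split: if_splits)
  define f where "f j = part xs j + (if j = i then 1 else 0)" for j
  have anti: "f b \<le> f a" if "1 \<le> a" "a \<le> b" for a b
  proof (cases "b = i \<and> a < i")
    case True
    then show ?thesis
      using eq[of a] i part_antimono[OF ys(1), of a i] that by (simp add: f_def)
  next
    case False
    then show ?thesis using part_antimono[OF xs(1) that] that by (auto simp: f_def)
  qed
  have zero: "f j = 0" if "max (length xs) (length ys) < j" for j
    using that i1 by (simp add: f_def part_beyond)
  obtain zs where zs: "is_partition zs" "\<And>j. 1 \<le> j \<Longrightarrow> part zs j = f j"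
    using partition_with_parts[of f, OF anti zero] by blast
  have part_zs: "part zs j = f j" for j
    using zs(2)[of j] i1 by (cases "j = 0") (auto simp: f_def)
  have "few_short_parts r m zs"
    unfolding few_short_parts_def
  proof (intro allI impI)
    fix j assume j: "1 \<le> j" "part zs (j + r) \<noteq> 0"
    show "m \<le> part zs j"
    proof (cases "j + r = i")
      case True
      then have "m \<le> part ys j" using ys(2) j i by (simp add: few_short_parts_def)
      then show ?thesis using eq[of j] True r by (simp add: part_zs f_def)
    next
      case False
      then have "m \<le> part xs j" using xs(2) j by (simp add: few_short_parts_def part_zs f_def)
      then show ?thesis by (simp add: part_zs f_def)
    qed
  qed
  moreover have "partition_le xs zs" by (simp add: partition_le_def part_zs f_def)
  moreover have "partition_le zs ys" using le i by (auto simp: partition_le_def part_zs f_def)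
  moreover have "sum_list zs = sum_list xs + 1"
  proof -
    define N where "N = length xs + length ys + length zs"
    have "sum_list zs = (\<Sum>j=1..N. part xs j + (if j = i then 1 else 0))"
      by (subst sum_list_eq_sum_part[of zs N]) (simp_all add: N_def part_zs f_def)
    also have "\<dots> = sum_list xs + 1"
      using i1 sum_list_eq_sum_part[of xs N] by (simp add: sum.distrib N_def)
    finally show ?thesis .
  qed
  ultimately show ?thesis using that zs(1) by blast
qed

lemma k_young_le_if_few_short_parts:
  assumes r: "1 \<le> r" "m + r = Suc k"
    and xs: "is_partition xs" "few_short_parts r m xs"
    and ys: "is_partition ys" "part ys 1 \<le> m" "few_short_parts r m ys"
    and le: "partition_le xs ys"
  shows "k_young_le k xs ys"
  using xs le
proof (induction "sum_list ys - sum_list xs" arbitrary: xs rule: less_induct)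
  case less
  show ?case
  proof (cases "xs = ys")
    case True
    then show ?thesis by (simp add: k_young_le_def)
  next
    case False
    then obtain zs where zs: "is_partition zs" "few_short_parts r m zs" "partition_le xs zs"
      "partition_le zs ys" "sum_list zs = sum_list xs + 1"
      using few_short_parts_step[OF r(1) less.prems(1,2) ys(1,3) less.prems(3)] by blast
    have "sum_list zs \<le> sum_list ys" by (rule sum_list_mono_partition[OF zs(4)])
    then have "k_young_le k zs ys" using less.hyps[of zs] zs by simp
    moreover have "k_young_cover k xs zs"
    proof -
      have zs1: "part zs 1 \<le> m" using zs(4) ys(2) by (meson order_trans partition_le_def)
      then have "part xs 1 \<le> m" using zs(3) by (meson order_trans partition_le_def)
      moreover have "m \<le> k" using r by simp
      ultimately show ?thesis
        using k_conjugate_mono_few[OF r less.prems(1,2) zs(1) zs1 zs(2,3)] zs zs1 less.prems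
        by (simp add: k_young_cover_def bounded_partitions_def)
    qed
    ultimately show ?thesis unfolding k_young_le_def by simp
  qed
qed

lemma partition_le_if_k_young_le: "k_young_le k xs ys \<Longrightarrow> partition_le xs ys"
  unfolding k_young_le_def
  by (induction rule: rtranclp_induct)
    (auto simp: k_young_cover_def partition_le_def intro: order_trans)

definition rect_partitions :: "nat \<Rightarrow> nat \<Rightarrow> nat \<Rightarrow> nat list set" where
  "rect_partitions r m n =
     {xs. is_partition xs \<and> partition_le xs (replicate n m) \<and> few_short_parts r m xs}"

lemma part_replicate: "part (replicate n m) i = (if 1 \<le> i \<and> i \<le> n then m else 0)"
  by (auto simp: part_def)

lemma rect_partitions_first: "xs \<in> rect_partitions r m n \<Longrightarrow> part xs 1 \<le> m"
  unfolding rect_partitions_def partition_le_def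
  by (auto simp: part_replicate split: if_splits dest: spec[of _ 1])

lemma k_young_le_rect_partitions:
  assumes "1 \<le> r" "m + r = Suc k" "xs \<in> rect_partitions r m n" "ys \<in> rect_partitions r m n"
  shows "k_young_le k xs ys \<longleftrightarrow> partition_le xs ys"
  using partition_le_if_k_young_le k_young_le_if_few_short_parts[OF assms(1,2), of xs ys]
    rect_partitions_first[OF assms(4)] assms(3,4)
  by (auto simp: rect_partitions_def)

lemma rectangle_in_rect_partitions:
  assumes "1 \<le> m"
  shows "replicate n m \<in> rect_partitions r m n"
  using assms
  by (auto simp: rect_partitions_def is_partition_def sorted_wrt_iff_nth_less partition_le_def
      few_short_parts_def part_replicate split: if_splits)

lemma carrier_rect_ideal:
  assumes r: "1 \<le> r" "m + r = Suc k" and "1 \<le> m"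
  shows "carrier (rect_ideal k m n) = rect_partitions r m n"
proof
  let ?R = "replicate n m"
  have R: "?R \<in> rect_partitions r m n" using assms by (simp add: rectangle_in_rect_partitions)
  show "carrier (rect_ideal k m n) \<subseteq> rect_partitions r m n"
  proof
    fix xs assume "xs \<in> carrier (rect_ideal k m n)"
    then have "(k_young_cover k)\<^sup>*\<^sup>* xs ?R" by (simp add: rect_ideal_def k_young_le_def)
    then show "xs \<in> rect_partitions r m n"
    proof (induction rule: converse_rtranclp_induct)
      \<comment> \<open>Descending along a cover never lengthens the first column, so it keeps at most \<open>r\<close> cells.\<close>
      case (step xs ys)
      have ys: "is_partition ys" "part ys 1 \<le> m" "few_short_parts r m ys"
        "partition_le ys ?R" using step.IH rect_partitions_first[OF step.IH] by (auto simp: rect_partitions_def)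
      have xs: "is_partition xs" "partition_le xs ys"
        "partition_le (k_conjugate k xs) (k_conjugate k ys)"
        using step.hyps(1) by (auto simp: k_young_cover_def bounded_partitions_def)
      have xs1: "part xs 1 \<le> m" using xs(2) ys(2) by (meson order_trans partition_le_def)
      have "part (k_conjugate k xs) 1 \<le> part (k_conjugate k ys) 1"
        using xs(3) by (simp add: partition_le_def)
      also have "\<dots> \<le> r" using part_k_conjugate_few[OF r ys(1-3), of 1] by simp
      finally have "few_short_parts r m xs"
        by (rule few_short_parts_if_k_conjugate_le[OF r xs(1) xs1])
      then show ?case
        using xs ys(4) partition_le_trans by (auto simp: rect_partitions_def)
    qed (rule R)
  qed
  show "rect_partitions r m n \<subseteq> carrier (rect_ideal k m n)"
  proof
    fix xs assume xs: "xs \<in> rect_partitions r m n"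
    then have "k_young_le k xs ?R"
      using k_young_le_rect_partitions[OF r xs R] by (simp add: rect_partitions_def)
    moreover have "xs \<in> bounded_partitions k"
      using xs rect_partitions_first[OF xs] r by (simp add: bounded_partitions_def rect_partitions_def)
    ultimately show "xs \<in> carrier (rect_ideal k m n)" by (simp add: rect_ideal_def)
  qed
qed

lemma rect_partitions_join:
  assumes xs: "xs \<in> rect_partitions r m n" and ys: "ys \<in> rect_partitions r m n"
  obtains zs where "zs \<in> rect_partitions r m n" "\<And>i. part zs i = max (part xs i) (part ys i)"
proof -
  have P: "is_partition xs" "is_partition ys" using assms by (auto simp: rect_partitions_def)
  obtain zs where zs: "is_partition zs" "\<And>i. 1 \<le> i \<Longrightarrow> part zs i = max (part xs i) (part ys i)"
  proof (rule partition_with_parts[of "\<lambda>i. max (part xs i) (part ys i)" "max (length xs) (length ys)"])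
    show "max (part xs b) (part ys b) \<le> max (part xs a) (part ys a)" if "1 \<le> a" "a \<le> b" for a b
      using part_antimono[OF P(1) that] part_antimono[OF P(2) that] by (rule max.mono)
  qed (auto simp: part_beyond)
  have part_zs: "part zs i = max (part xs i) (part ys i)" for i
    using zs(2)[of i] by (cases "i = 0") auto
  have "few_short_parts r m zs"
    using xs ys by (auto simp: rect_partitions_def few_short_parts_def part_zs le_max_iff_disj)
  then have "zs \<in> rect_partitions r m n"
    using xs ys zs(1) by (auto simp: rect_partitions_def partition_le_def part_zs)
  with part_zs show ?thesis using that by blast
qed

lemma rect_partitions_meet:
  assumes xs: "xs \<in> rect_partitions r m n" and ys: "ys \<in> rect_partitions r m n"
  obtains zs where "zs \<in> rect_partitions r m n" "\<And>i. part zs i = min (part xs i) (part ys i)"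
proof -
  have P: "is_partition xs" "is_partition ys" using assms by (auto simp: rect_partitions_def)
  obtain zs where zs: "is_partition zs" "\<And>i. 1 \<le> i \<Longrightarrow> part zs i = min (part xs i) (part ys i)"
  proof (rule partition_with_parts[of "\<lambda>i. min (part xs i) (part ys i)" "length xs"])
    show "min (part xs b) (part ys b) \<le> min (part xs a) (part ys a)" if "1 \<le> a" "a \<le> b" for a b
      using part_antimono[OF P(1) that] part_antimono[OF P(2) that] by (rule min.mono)
  qed (auto simp: part_beyond)
  have part_zs: "part zs i = min (part xs i) (part ys i)" for i
    using zs(2)[of i] by (cases "i = 0") auto
  have "few_short_parts r m zs"
    using xs ys by (auto simp: rect_partitions_def few_short_parts_def part_zs)
  then have "zs \<in> rect_partitions r m n"
    using xs zs(1) by (auto simp: rect_partitions_def partition_le_def part_zs min.coboundedI1)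
  with part_zs show ?thesis using that by blast
qed

theorem corollary35:
  fixes k m n :: nat
  assumes "1 \<le> m" and "1 \<le> n" and "m \<le> k"
  shows "lattice (rect_ideal k m n)"
proof -
  define r where "r = k + 1 - m"
  let ?L = "rect_ideal k m n" and ?S = "rect_partitions r m n"
  have r: "1 \<le> r" "m + r = Suc k" using assms by (auto simp: r_def)
  have carrier: "carrier ?L = ?S" by (rule carrier_rect_ideal[OF r assms(1)])
  have eq: "eq ?L = (=)" by (simp add: rect_ideal_def)
  have le: "le ?L xs ys \<longleftrightarrow> partition_le xs ys" if "xs \<in> ?S" "ys \<in> ?S" for xs ys
    using k_young_le_rect_partitions[OF r that] by (simp add: rect_ideal_def)
  have "partial_order ?L"
  proof
    show "le ?L x x" if "x \<in> carrier ?L" for x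
      using that by (simp add: carrier le partition_le_def)
    show "x .=\<^bsub>?L\<^esub> y" if "le ?L x y" "le ?L y x" "x \<in> carrier ?L" "y \<in> carrier ?L" for x y
      using that partition_le_antisym by (auto simp: carrier le eq rect_partitions_def)
    show "le ?L x z" if "le ?L x y" "le ?L y z" "x \<in> carrier ?L" "y \<in> carrier ?L" "z \<in> carrier ?L"
      for x y z
      using that partition_le_trans[of x y z] by (auto simp: carrier le)
  qed (auto simp: eq)
  then interpret partial_order ?L .
  show ?thesis
  proof
    fix x y assume "x \<in> carrier ?L" "y \<in> carrier ?L"
    then have x: "x \<in> ?S" and y: "y \<in> ?S" by (auto simp: carrier)
    obtain z where z: "z \<in> ?S" "\<And>i. part z i = max (part x i) (part y i)"
      using rect_partitions_join[OF x y] by blast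
    have "least ?L z (Upper ?L {x, y})"
      unfolding least_def Upper_def
      using x y z by (auto simp: carrier le partition_le_def)
    then show "\<exists>s. least ?L s (Upper ?L {x, y})" by blast
    obtain z where z: "z \<in> ?S" "\<And>i. part z i = min (part x i) (part y i)"
      using rect_partitions_meet[OF x y] by blast
    have "greatest ?L z (Lower ?L {x, y})"
      unfolding greatest_def Lower_def
      using x y z by (auto simp: carrier le partition_le_def)
    then show "\<exists>s. greatest ?L s (Lower ?L {x, y})" by blast
  qed
qed

end
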